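(* Let $q$ be an odd prime power, $d=q-1$, and let $\phi\in\mathbb R^{\mathbb F_q^\times}$ be a unit vector. If $\sigma_{\min}(\mathcal M_\phi)=1$, then $$\sum_{m\in\mathbb F_q^\times}|\phi(m)|^4=\frac2q,\qquad |c_\phi(\chi)|=\frac1{\sqrt q}\quad\text{for every nontrivial multiplicative character }\chi\text{ of }\mathbb F_q^\times,\qquad B_\phi^*B_\phi=\frac1q I_{d-1}.$$
   Context: $G_q=\mathbb F_q\rtimes\mathbb F_q^\times$ is the affine group with product $(k,l)(k',l')=(k+lk',ll')$, acting on $\mathbb C^{\mathbb F_q^\times}$ by the unitary representation $(\pi_q(k,l)f)(m)=\psi(km)f(lm)$, where $\psi$ is any fixed nontrivial additive character of $\mathbb F_q$. For a vector $\phi$, $\mathcal M_\phi:\mathbb C^{\mathbb F_q^\times\times\mathbb F_q^\times}\to\mathbb C^{G_q}$ is the linear map $\mathcal M_\phi(A)(g)=\langle A\pi_q(g)\phi,\pi_q(g)\phi\rangle$, and $\sigma_{\min}(\mathcal M_\phi)=\min_{A\ne0}\|\mathcal M_\phi(A)\|_{\ell^2(G_q)}/\|A\|_F$ (Frobenius norm; counting measure on $G_q$). For real $\phi$: $c_\phi(\chi)=\sum_{m\in\mathbb F_q^\times}|\phi(-m)|^2\chi(m)$, and $B_\phi$ is the $d\times(d-1)$ matrix $B_\phi(m,t)=\phi(mt)\phi(m(t+1))$, $m\in\mathbb F_q^\times$, $t\in\mathbb F_q\setminus\{0,-1\}$. *)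

theory Defs
  imports "HOL-Analysis.Analysis" "HOL-Algebra.Group"
begin

text \<open>
  The finite field \<open>F\<^sub>q\<close> is a type \<open>'a\<close> of sort \<open>{field, finite}\<close> with \<open>q = CARD('a)\<close>.  Vectors
  indexed by its nonzero elements are functions on \<open>'a\<close>, and square matrices are functions of
  two arguments; only their values at nonzero arguments are ever used.
\<close>

abbreviation Fstar :: "'a::field set" where
  "Fstar \<equiv> {x. x \<noteq> 0}"

definition affine_group :: "('a::field \<times> 'a) monoid" where
  "affine_group = \<lparr>carrier = UNIV \<times> Fstar,
     mult = (\<lambda>(k, l) (k', l'). (k + l * k', l * l')), one = (0, 1)\<rparr>"

text \<open>Characters are homomorphisms into the multiplicative group of nonzero complex numbers; by
  finiteness of the domain their values lie on the unit circle.\<close>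

definition add_character :: "('a::field \<Rightarrow> complex) \<Rightarrow> bool" where
  "add_character \<psi> \<longleftrightarrow> (\<forall>x. \<psi> x \<noteq> 0) \<and> (\<forall>x y. \<psi> (x + y) = \<psi> x * \<psi> y)"

definition nontrivial_add_character :: "('a::field \<Rightarrow> complex) \<Rightarrow> bool" where
  "nontrivial_add_character \<psi> \<longleftrightarrow> add_character \<psi> \<and> (\<exists>x. \<psi> x \<noteq> 1)"

definition mult_character :: "('a::field \<Rightarrow> complex) \<Rightarrow> bool" where
  "mult_character \<eta> \<longleftrightarrow>
     (\<forall>x\<in>Fstar. \<eta> x \<noteq> 0) \<and> (\<forall>x\<in>Fstar. \<forall>y\<in>Fstar. \<eta> (x * y) = \<eta> x * \<eta> y)"

definition nontrivial_mult_character :: "('a::field \<Rightarrow> complex) \<Rightarrow> bool" where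
  "nontrivial_mult_character \<eta> \<longleftrightarrow> mult_character \<eta> \<and> (\<exists>x\<in>Fstar. \<eta> x \<noteq> 1)"

definition aff_rep ::
    "('a::field \<Rightarrow> complex) \<Rightarrow> 'a \<times> 'a \<Rightarrow> ('a \<Rightarrow> complex) \<Rightarrow> 'a \<Rightarrow> complex" where
  "aff_rep \<psi> = (\<lambda>(k, l) f m. \<psi> (k * m) * f (l * m))"

definition hinner :: "('a::field \<Rightarrow> complex) \<Rightarrow> ('a \<Rightarrow> complex) \<Rightarrow> complex" where
  "hinner u v = (\<Sum>m\<in>Fstar. u m * cnj (v m))"

definition mat_app :: "('a::field \<Rightarrow> 'a \<Rightarrow> complex) \<Rightarrow> ('a \<Rightarrow> complex) \<Rightarrow> 'a \<Rightarrow> complex" where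
  "mat_app A v m = (\<Sum>n\<in>Fstar. A m n * v n)"

definition frob_norm :: "('a::field \<Rightarrow> 'a \<Rightarrow> complex) \<Rightarrow> real" where
  "frob_norm A = L2_set (\<lambda>(m, n). cmod (A m n)) (Fstar \<times> Fstar)"

definition meas_map ::
    "('a::field \<Rightarrow> complex) \<Rightarrow> ('a \<Rightarrow> complex) \<Rightarrow> ('a \<Rightarrow> 'a \<Rightarrow> complex) \<Rightarrow> 'a \<times> 'a \<Rightarrow> complex" where
  "meas_map \<psi> \<phi> A g = hinner (mat_app A (aff_rep \<psi> g \<phi>)) (aff_rep \<psi> g \<phi>)"

text \<open>The infimum is a minimum, see \<open>sigma_min_attained\<close> and \<open>sigma_min_le\<close> below.\<close>

definition sigma_min :: "('a::{field,finite} \<Rightarrow> complex) \<Rightarrow> ('a \<Rightarrow> complex) \<Rightarrow> real" where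
  "sigma_min \<psi> \<phi> =
     (INF A \<in> {A. \<exists>m\<in>Fstar. \<exists>n\<in>Fstar. A m n \<noteq> 0}.
        L2_set (\<lambda>g. cmod (meas_map \<psi> \<phi> A g)) (carrier affine_group) / frob_norm A)"

definition c_coeff :: "('a::{field,finite} \<Rightarrow> real) \<Rightarrow> ('a \<Rightarrow> complex) \<Rightarrow> complex" where
  "c_coeff \<phi> \<eta> = (\<Sum>m\<in>Fstar. of_real (\<bar>\<phi> (- m)\<bar>\<^sup>2) * \<eta> m)"

text \<open>Rows are indexed by \<open>Fstar\<close>, columns by \<open>UNIV - {0, - 1}\<close>; the matrix is real,
  so its adjoint is its transpose.\<close>

definition B_mat :: "('a::field \<Rightarrow> real) \<Rightarrow> 'a \<Rightarrow> 'a \<Rightarrow> real" where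
  "B_mat \<phi> m t = \<phi> (m * t) * \<phi> (m * (t + 1))"

lemma group_affine_group: "group (affine_group :: ('a::field \<times> 'a) monoid)"
proof (rule groupI)
  fix x :: "'a \<times> 'a" assume "x \<in> carrier affine_group"
  then show "\<exists>y\<in>carrier affine_group. y \<otimes>\<^bsub>affine_group\<^esub> x = \<one>\<^bsub>affine_group\<^esub>"
    by (intro bexI[of _ "(- fst x / snd x, 1 / snd x)"]) (auto simp: affine_group_def)
qed (auto simp: affine_group_def algebra_simps)

lemma aff_rep_mult:
  assumes "add_character \<psi>"
  shows "aff_rep \<psi> (g \<otimes>\<^bsub>affine_group\<^esub> h) f = aff_rep \<psi> g (aff_rep \<psi> h f)"
proof -
  have *: "\<psi> (x + y) = \<psi> x * \<psi> y" for x y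
    using assms by (simp add: add_character_def)
  show ?thesis
    by (auto simp: aff_rep_def affine_group_def fun_eq_iff *[symmetric] algebra_simps
        split: prod.splits)
qed

lemma frob_norm_pos:
  fixes A :: "'a::{field,finite} \<Rightarrow> 'a \<Rightarrow> complex"
  assumes "m \<noteq> 0" "n \<noteq> 0" "A m n \<noteq> 0"
  shows "frob_norm A > 0"
proof -
  have "frob_norm A \<noteq> 0"
    using assms by (auto simp: frob_norm_def L2_set_eq_0_iff)
  moreover have "frob_norm A \<ge> 0" by (simp add: frob_norm_def)
  ultimately show ?thesis by simp
qed

lemma sigma_min_le:
  fixes A :: "'a::{field,finite} \<Rightarrow> 'a \<Rightarrow> complex"
  assumes "m \<noteq> 0" "n \<noteq> 0" "A m n \<noteq> 0"
  shows "sigma_min \<psi> \<phi> \<le>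
    L2_set (\<lambda>g. cmod (meas_map \<psi> \<phi> A g)) (carrier affine_group) / frob_norm A"
  unfolding sigma_min_def
proof (rule cINF_lower)
  show "bdd_below ((\<lambda>A. L2_set (\<lambda>g. cmod (meas_map \<psi> \<phi> A g)) (carrier affine_group) / frob_norm A)
     ` {A. \<exists>m\<in>Fstar. \<exists>n\<in>Fstar. A m n \<noteq> 0})"
    by (rule bdd_belowI[of _ 0]) (auto simp: frob_norm_def)
qed (use assms in auto)

lemma sigma_min_attained:
  fixes \<psi> \<phi> :: "'a::{field,finite} \<Rightarrow> complex"
  shows "\<exists>A. (\<exists>m\<in>Fstar. \<exists>n\<in>Fstar. A m n \<noteq> 0) \<and> sigma_min \<psi> \<phi> =
    L2_set (\<lambda>g. cmod (meas_map \<psi> \<phi> A g)) (carrier affine_group) / frob_norm A"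
proof -
  define F :: "('a \<Rightarrow> 'a \<Rightarrow> complex) \<Rightarrow> real"
    where "F = (\<lambda>A. L2_set (\<lambda>g. cmod (meas_map \<psi> \<phi> A g)) (carrier affine_group))"
  define N where "N = {A::'a \<Rightarrow> 'a \<Rightarrow> complex. \<exists>m\<in>Fstar. \<exists>n\<in>Fstar. A m n \<noteq> 0}"
  define e where "e = (\<lambda>x::((complex, 'a) vec, 'a) vec. \<lambda>m n. x $ m $ n)"
  define K where "K = {x::((complex, 'a) vec, 'a) vec. frob_norm (e x) = 1} \<inter>
     {x. \<forall>m n. m = 0 \<or> n = 0 \<longrightarrow> x $ m $ n = 0}"
  have F_scale: "F (\<lambda>m n. of_real c * A m n) = c * F A" if "c \<ge> 0" for c A
  proof -
    have "meas_map \<psi> \<phi> (\<lambda>m n. of_real c * A m n) g = of_real c * meas_map \<psi> \<phi> A g" for g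
      by (simp add: meas_map_def hinner_def mat_app_def sum_distrib_left sum_distrib_right mult_ac)
    then show ?thesis
      using that by (simp add: F_def norm_mult L2_set_right_distrib)
  qed
  have N_scale: "frob_norm (\<lambda>m n. of_real c * A m n) = c * frob_norm A"
    if "c \<ge> 0" for c and A :: "'a \<Rightarrow> 'a \<Rightarrow> complex"
    using that by (simp add: frob_norm_def norm_mult L2_set_right_distrib case_prod_unfold)
  have contN: "continuous_on S (\<lambda>x. frob_norm (e x))" for S
    unfolding frob_norm_def e_def L2_set_def case_prod_beta by (intro continuous_intros)
  have contF: "continuous_on S (\<lambda>x. F (e x))" for S
    unfolding F_def e_def L2_set_def meas_map_def hinner_def mat_app_def
    by (intro continuous_intros)
  have "closed {x. frob_norm (e x) = 1}"
    by (intro closed_Collect_eq contN continuous_on_const)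
  moreover have "closed {x::((complex, 'a) vec, 'a) vec. \<forall>m n. m = 0 \<or> n = 0 \<longrightarrow> x $ m $ n = 0}"
    by (intro closed_Collect_all closed_Collect_imp open_Collect_const closed_Collect_eq
        continuous_intros)
  ultimately have "closed K" unfolding K_def by (rule closed_Int)
  moreover have "bounded K"
  proof (rule boundedI)
    fix x assume x: "x \<in> K"
    have "norm (x $ m $ n) \<le> 1" for m n
    proof (cases "m = 0 \<or> n = 0")
      case False
      then have "(\<lambda>(m, n). cmod (e x m n)) (m, n) \<le> frob_norm (e x)"
        unfolding frob_norm_def by (intro member_le_L2_set) auto
      then show ?thesis using x by (simp add: K_def e_def)
    qed (use x in \<open>auto simp: K_def\<close>)
    then have row: "norm (x $ m) \<le> (\<Sum>n\<in>(UNIV::'a set). 1)" for m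
      unfolding norm_vec_def by (intro order.trans[OF L2_set_le_sum] sum_mono) auto
    show "norm x \<le> (\<Sum>m\<in>(UNIV::'a set). \<Sum>n\<in>(UNIV::'a set). 1)"
      unfolding norm_vec_def[of x] by (intro order.trans[OF L2_set_le_sum] sum_mono row) auto
  qed
  ultimately have "compact K" by (simp add: compact_eq_bounded_closed)
  have red: "\<exists>x\<in>K. F (e x) = F A / frob_norm A" if A: "A \<in> N" for A
  proof -
    from A have pos: "frob_norm A > 0" unfolding N_def using frob_norm_pos[of _ _ A] by blast
    define c where "c = 1 / frob_norm A"
    define A' where "A' = (\<lambda>m n. complex_of_real c * A m n)"
    define x :: "((complex, 'a) vec, 'a) vec" where "x = (\<chi> m n. if m = 0 \<or> n = 0 then 0 else A' m n)"
    have eN: "frob_norm (e x) = frob_norm A'"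
      unfolding frob_norm_def by (intro L2_set_cong) (auto simp: e_def x_def)
    have eF: "F (e x) = F A'"
      unfolding F_def meas_map_def hinner_def mat_app_def
      by (intro L2_set_cong refl arg_cong[of _ _ cmod] sum.cong arg_cong2[of _ _ _ _ times])
         (auto simp: e_def x_def)
    have "c \<ge> 0" using pos by (simp add: c_def)
    then have "frob_norm A' = 1" "F A' = F A / frob_norm A"
      using pos unfolding A'_def by (simp_all add: N_scale F_scale, simp_all add: c_def)
    moreover have "x $ m $ n = 0" if "m = 0 \<or> n = 0" for m n
      using that by (simp add: x_def)
    ultimately show ?thesis
      by (intro bexI[of _ x]) (auto simp: K_def eN eF)
  qed
  have KN: "e x \<in> N" if x: "x \<in> K" for x
  proof (rule ccontr)
    assume "e x \<notin> N"
    then have "frob_norm (e x) = 0"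
      unfolding frob_norm_def N_def by (subst L2_set_eq_0_iff) auto
    with x show False by (simp add: K_def)
  qed
  have "(\<lambda>m n. 1) \<in> N"
    by (auto simp: N_def intro!: exI[of _ "1::'a"])
  with red have "K \<noteq> {}" by blast
  obtain x where x: "x \<in> K" "\<And>y. y \<in> K \<Longrightarrow> F (e x) \<le> F (e y)"
    using continuous_attains_inf[OF \<open>compact K\<close> \<open>K \<noteq> {}\<close> contF] by blast
  have fx: "frob_norm (e x) = 1" using x(1) by (simp add: K_def)
  have "sigma_min \<psi> \<phi> = (INF A\<in>N. F A / frob_norm A)"
    by (simp add: sigma_min_def F_def N_def)
  also have "\<dots> = F (e x) / frob_norm (e x)"
  proof (rule cInf_eq_minimum)
    show "F (e x) / frob_norm (e x) \<in> (\<lambda>A. F A / frob_norm A) ` N"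
      using KN[OF x(1)] by blast
    fix y assume "y \<in> (\<lambda>A. F A / frob_norm A) ` N"
    then obtain A where A: "A \<in> N" "y = F A / frob_norm A" by blast
    then obtain z where "z \<in> K" "F (e z) = y" using red by blast
    then show "F (e x) / frob_norm (e x) \<le> y" using x(2) fx by auto
  qed
  finally show ?thesis
    using KN[OF x(1)] unfolding F_def N_def by (intro exI[of _ "e x"]) blast
qed

end

theory Submission
  imports Defs
begin

text \<open>
  Testing \<open>\<sigma>\<^sub>m\<^sub>i\<^sub>n \<ge> 1\<close> only on matrices supported on the diagonal and on one off-diagonal
  \<open>n = m + 1\<close> suffices: there \<open>|M\<^sub>\<phi>(A)(k, l)|\<close> does not depend on \<open>k\<close>.  With
  \<open>C(l, m) = \<phi>(lm)\<^sup>2\<close> this yields \<open>C\<^sup>*C \<ge> I/q\<close> and \<open>B\<^sup>*B \<ge> I/q\<close>.  As \<open>C\<close> and \<open>C\<^sup>*\<close> fix the constant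
  vector, the first inequality improves to \<open>C\<^sup>*C \<ge> (I + J)/q\<close> with \<open>J\<close> the all-ones matrix.
  Taking traces gives \<open>\<Sum>\<phi>\<^sup>4 \<ge> 2/q\<close> and \<open>1 - \<Sum>\<phi>\<^sup>4 \<ge> (q - 2)/q\<close>, so both
  inequalities are equalities of traces and hence of matrices.  Applying \<open>C\<^sup>*C = (I + J)/q\<close> to a
  nontrivial character \<open>\<chi>\<close>, for which \<open>J\<chi> = 0\<close> and \<open>C\<chi>\<close> is a multiple of the conjugate of \<open>\<chi>\<close>, gives
  \<open>|c\<^sub>\<phi>(\<chi>)|\<^sup>2 = 1/q\<close>.
\<close>

section \<open>Sums over \<open>Fstar\<close>, cardinalities and absolute values of
  characters\<close>

lemma sum_Fstar_mult:
  fixes l :: "'a::{field,finite}"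
  assumes "l \<noteq> 0"
  shows "(\<Sum>m\<in>Fstar. f (l * m)) = (\<Sum>m\<in>Fstar. f m)"
  by (rule sum.reindex_bij_witness[of _ "\<lambda>m. m / l" "\<lambda>m. l * m"]) (use assms in auto)

lemma card_Fstar: "real (card (Fstar :: 'a::{field,finite} set)) = real CARD('a) - 1"
proof -
  have "(Fstar :: 'a set) = UNIV - {0}" by auto
  moreover have "CARD('a) \<ge> 1" by (simp add: Suc_leI)
  ultimately show ?thesis by (simp add: card_Diff_singleton of_nat_diff)
qed

lemma card_two_le: "2 \<le> CARD('a::{field,finite})"
  using card_mono[of UNIV "{0, 1::'a}"] by simp

lemma card_no_zero_neg_one:
  "real (card (UNIV - {0, - 1 :: 'a::{field,finite}})) = real CARD('a) - 2"
  using card_two_le[where 'a='a] by (simp add: card_Diff_subset of_nat_diff)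

text \<open>Multiplying by \<open>cmod (\<psi> x)\<close> only permutes the terms of the sum of
  \<open>cmod (\<psi> y)\<close> over the field, and that sum is positive, so the factor must be 1.
  No roots of unity are involved.\<close>

lemma cmod_add_character:
  fixes \<psi> :: "'a::{field,finite} \<Rightarrow> complex"
  assumes "add_character \<psi>"
  shows "cmod (\<psi> x) = 1"
proof -
  have nz: "\<psi> y \<noteq> 0" and add: "\<psi> (x + y) = \<psi> x * \<psi> y" for y
    using assms by (simp_all add: add_character_def)
  have "cmod (\<psi> x) * (\<Sum>y\<in>UNIV. cmod (\<psi> y)) = (\<Sum>y\<in>UNIV. cmod (\<psi> (x + y)))"
    by (simp add: add norm_mult sum_distrib_left)
  also have "\<dots> = (\<Sum>y\<in>UNIV. cmod (\<psi> y))"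
    by (rule sum.reindex_bij_witness[of _ "\<lambda>y. y - x" "\<lambda>y. x + y"]) auto
  finally show ?thesis
    using sum_pos[of "UNIV :: 'a set" "\<lambda>y. cmod (\<psi> y)"] nz by simp
qed

lemma cmod_mult_character:
  fixes \<eta> :: "'a::{field,finite} \<Rightarrow> complex"
  assumes "mult_character \<eta>" and x: "x \<noteq> 0"
  shows "cmod (\<eta> x) = 1"
proof -
  have nz: "\<eta> y \<noteq> 0" and mult: "\<eta> (x * y) = \<eta> x * \<eta> y" if "y \<in> Fstar" for y
    using assms that by (simp_all add: mult_character_def)
  have "cmod (\<eta> x) * (\<Sum>y\<in>Fstar. cmod (\<eta> y)) = (\<Sum>y\<in>Fstar. cmod (\<eta> (x * y)))"
    by (simp add: mult norm_mult sum_distrib_left)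
  also have "\<dots> = (\<Sum>y\<in>Fstar. cmod (\<eta> y))"
    by (rule sum_Fstar_mult[OF x])
  finally show ?thesis
    using sum_pos[of "Fstar :: 'a set" "\<lambda>y. cmod (\<eta> y)"] nz x by fastforce
qed

lemma sum_nontrivial_mult_character:
  fixes \<eta> :: "'a::{field,finite} \<Rightarrow> complex"
  assumes "nontrivial_mult_character \<eta>"
  shows "(\<Sum>m\<in>Fstar. \<eta> m) = 0"
proof -
  obtain x where x: "x \<noteq> 0" "\<eta> x \<noteq> 1" and mult: "\<And>y. y \<in> Fstar \<Longrightarrow> \<eta> (x * y) = \<eta> x * \<eta> y"
    using assms by (auto simp: nontrivial_mult_character_def mult_character_def)
  have "\<eta> x * (\<Sum>m\<in>Fstar. \<eta> m) = (\<Sum>m\<in>Fstar. \<eta> (x * m))"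
    by (simp add: mult sum_distrib_left)
  also have "\<dots> = (\<Sum>m\<in>Fstar. \<eta> m)"
    by (rule sum_Fstar_mult[OF x(1)])
  finally show ?thesis using x(2) by simp
qed

section \<open>Positive semidefinite forms, traces and Gram matrices\<close>

text \<open>Unit vectors show that the diagonal is nonnegative, so the trace bound makes it vanish.
  On two coordinates only a cross term is then left; it is linear in one coordinate, and a change of
  sign there forces its coefficient to be 0.\<close>

lemma psd_zero_of_trace_le_zero:
  fixes G :: "'i \<Rightarrow> 'i \<Rightarrow> real"
  assumes fin: "finite I"
    and sym: "\<And>i j. G i j = G j i"
    and psd: "\<And>x. 0 \<le> (\<Sum>i\<in>I. \<Sum>j\<in>I. x i * x j * G i j)"
    and trace: "(\<Sum>i\<in>I. G i i) \<le> 0"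
    and ij: "i \<in> I" "j \<in> I"
  shows "G i j = 0"
proof -
  \<comment> \<open>Only vectors supported on at most two indices are tested; \<open>a = b\<close>
    covers the case of one index.\<close>
  have quad: "(\<Sum>i\<in>I. \<Sum>j\<in>I. x i * x j * G i j) = (\<Sum>i\<in>{a, b}. \<Sum>j\<in>{a, b}. x i * x j * G i j)"
    if "a \<in> I" "b \<in> I" "\<And>k. k \<notin> {a, b} \<Longrightarrow> x k = 0" for x a b
    using fin that by (intro sum.mono_neutral_cong_right ballI) auto
  have diag_nonneg: "0 \<le> G a a" if "a \<in> I" for a
    using psd[of "\<lambda>k. if k = a then 1 else 0"] quad[of a a "\<lambda>k. if k = a then 1 else 0"] that
    by simp
  have diag: "G a a = 0" if "a \<in> I" for a
  proof -
    have "(\<Sum>i\<in>I. G i i) = 0" using trace sum_nonneg[of I "\<lambda>i. G i i"] diag_nonneg by force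
    then show ?thesis using sum_nonneg_eq_0_iff[OF fin, of "\<lambda>i. G i i"] diag_nonneg that by blast
  qed
  show ?thesis
  proof (cases "i = j")
    case False
    have "0 \<le> 2 * s * G i j" for s
      using psd[of "\<lambda>k. if k = i then 1 else if k = j then s else 0"]
        quad[OF ij, of "\<lambda>k. if k = i then 1 else if k = j then s else 0"] False
        diag[OF ij(1)] diag[OF ij(2)] sym[of j i]
      by simp
    from this[of 1] this[of "-1"] show ?thesis by simp
  qed (use diag ij in simp)
qed

lemma psd_trace_nonneg:
  fixes G :: "'i \<Rightarrow> 'i \<Rightarrow> real"
  assumes fin: "finite I"
    and psd: "\<And>x. 0 \<le> (\<Sum>i\<in>I. \<Sum>j\<in>I. x i * x j * G i j)"
  shows "0 \<le> (\<Sum>i\<in>I. G i i)"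
proof (rule sum_nonneg)
  fix a assume a: "a \<in> I"
  have "(if i = a then 1 else 0) * (if j = a then 1 else 0) * G i j =
      (if i = a then if j = a then G i j else 0 else 0)" for i j by simp
  moreover have "(\<Sum>i\<in>I. \<Sum>j\<in>I. if i = a then if j = a then G i j else 0 else 0) = G a a"
    using fin a by (subst sum.swap) simp
  ultimately show "0 \<le> G a a"
    using psd[of "\<lambda>k. if k = a then 1 else 0"] by simp
qed

text \<open>Translates lower bounds on sums of squares into positivity of a Gram matrix minus a
  correction.\<close>

lemma sum_square_gram:
  fixes v :: "'l \<Rightarrow> 'i \<Rightarrow> real"
  shows "(\<Sum>l\<in>L. (\<Sum>i\<in>I. x i * v l i)\<^sup>2) = (\<Sum>i\<in>I. \<Sum>j\<in>I. x i * x j * (\<Sum>l\<in>L. v l i * v l j))"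
proof -
  have "(\<Sum>l\<in>L. (\<Sum>i\<in>I. x i * v l i)\<^sup>2) = (\<Sum>l\<in>L. \<Sum>i\<in>I. \<Sum>j\<in>I. x i * x j * (v l i * v l j))"
    by (simp add: power2_eq_square sum_product mult_ac)
  also have "\<dots> = (\<Sum>i\<in>I. \<Sum>j\<in>I. \<Sum>l\<in>L. x i * x j * (v l i * v l j))"
    by (subst sum.swap) (intro sum.cong refl sum.swap)
  finally show ?thesis by (simp add: sum_distrib_left)
qed

lemma sum_square_diag:
  fixes x :: "'i \<Rightarrow> real"
  assumes "finite I"
  shows "(\<Sum>i\<in>I. \<Sum>j\<in>I. x i * x j * (if i = j then c else 0)) = c * (\<Sum>i\<in>I. (x i)\<^sup>2)"
proof -
  have "x i * x j * (if i = j then c else 0) = (if i = j then c * (x i)\<^sup>2 else 0)" for i j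
    by (simp add: power2_eq_square)
  then show ?thesis using assms by (simp add: sum_distrib_left)
qed

section \<open>The inequality obtained from matrices supported on one shifted diagonal\<close>

text \<open>For a matrix supported on \<open>n = m + s\<close>, every term of the measurement at
  \<open>(k, l)\<close> carries the same phase \<open>\<psi> (k * s)\<close>. The absolute value is
  thus free of \<open>k\<close>, and summing over \<open>k\<close> produces the factor
  \<open>CARD('a)\<close>. The shift 0 will give squares of entries, the shift 1 the matrix
  \<open>B_mat\<close>.\<close>

lemma shifted_diagonal_bound:
  fixes \<psi> :: "'a::{field,finite} \<Rightarrow> complex" and \<phi> x :: "'a \<Rightarrow> real" and s :: 'a
  assumes \<psi>: "add_character \<psi>"
    and \<sigma>: "1 \<le> sigma_min \<psi> (\<lambda>m. complex_of_real (\<phi> m))"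
  defines "T \<equiv> {t. t \<noteq> 0 \<and> t + s \<noteq> 0}"
  shows "(\<Sum>t\<in>T. (x t)\<^sup>2) \<le>
    real CARD('a) * (\<Sum>l\<in>Fstar. (\<Sum>t\<in>T. x t * (\<phi> (l * t) * \<phi> (l * (t + s))))\<^sup>2)"
\<comment> \<open>The quotient in \<open>sigma_min\<close> ranges over nonzero matrices only; if
  \<open>x\<close> vanishes on \<open>T\<close>, the left side is 0.\<close>
proof (cases "\<exists>t\<in>T. x t \<noteq> 0")
  case True
  then obtain t where t: "t \<noteq> 0" "t + s \<noteq> 0" "x t \<noteq> 0" by (auto simp: T_def)
  define A :: "'a \<Rightarrow> 'a \<Rightarrow> complex" where "A m n = (if n = m + s then of_real (x m) else 0)" for m n
  let ?M = "\<lambda>g. cmod (meas_map \<psi> (\<lambda>m. complex_of_real (\<phi> m)) A g)"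
  have add: "\<psi> (u + v) = \<psi> u * \<psi> v" for u v using \<psi> by (simp add: add_character_def)
  have unit: "\<psi> u * cnj (\<psi> u) = 1" for u
    by (simp add: complex_norm_square[symmetric] cmod_add_character[OF \<psi>])
  have frob: "(frob_norm A)\<^sup>2 = (\<Sum>t\<in>T. (x t)\<^sup>2)"
  proof -
    have "(frob_norm A)\<^sup>2 = (\<Sum>m\<in>Fstar. \<Sum>n\<in>Fstar. (cmod (A m n))\<^sup>2)"
      unfolding frob_norm_def L2_set_def
      by (simp add: sum_nonneg case_prod_unfold sum.cartesian_product)
    also have "\<dots> = (\<Sum>m\<in>Fstar. if m + s \<noteq> 0 then (x m)\<^sup>2 else 0)"
      by (intro sum.cong refl) (simp add: A_def if_distrib[of cmod] if_distrib[of "\<lambda>u. u\<^sup>2"] cong: if_cong)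
    also have "\<dots> = (\<Sum>t\<in>T. (x t)\<^sup>2)"
      by (rule sum.mono_neutral_cong_right) (auto simp: T_def)
    finally show ?thesis .
  qed
  have M: "?M (k, l) = \<bar>\<Sum>t\<in>T. x t * (\<phi> (l * t) * \<phi> (l * (t + s)))\<bar>" for k l
  proof -
    let ?u = "aff_rep \<psi> (k, l) (\<lambda>m. complex_of_real (\<phi> m))"
    have app: "mat_app A ?u m = (if m + s \<noteq> 0 then x m * ?u (m + s) else 0)" for m
    proof -
      have "A m n * ?u n = (if n = m + s then x m * ?u (m + s) else 0)" for n by (simp add: A_def)
      then show ?thesis by (simp add: mat_app_def)
    qed
    have "meas_map \<psi> (\<lambda>m. complex_of_real (\<phi> m)) A (k, l) =
        (\<Sum>m\<in>Fstar. mat_app A ?u m * cnj (?u m))"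
      by (simp add: meas_map_def hinner_def)
    also have "\<dots> = (\<Sum>t\<in>T. x t * ?u (t + s) * cnj (?u t))"
      by (rule sum.mono_neutral_cong_right) (auto simp: T_def app)
    also have "\<dots> = (\<Sum>t\<in>T. \<psi> (k * s) * of_real (x t * (\<phi> (l * t) * \<phi> (l * (t + s)))))"
    proof (rule sum.cong)
      fix t
      \<comment> \<open>Additivity splits \<open>\<psi> (k * (t + s))\<close>; the part depending on
        \<open>t\<close> cancels against the conjugate factor.\<close>
      have "x t * ?u (t + s) * cnj (?u t) = (\<psi> (k * t) * cnj (\<psi> (k * t))) *
          (\<psi> (k * s) * of_real (x t * (\<phi> (l * t) * \<phi> (l * (t + s)))))"
        by (simp add: aff_rep_def distrib_left[of k] add mult_ac)
      then show "x t * ?u (t + s) * cnj (?u t) =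
          \<psi> (k * s) * of_real (x t * (\<phi> (l * t) * \<phi> (l * (t + s))))"
        by (simp only: unit mult_1)
    qed simp
    also have "\<dots> = \<psi> (k * s) * of_real (\<Sum>t\<in>T. x t * (\<phi> (l * t) * \<phi> (l * (t + s))))"
      by (simp only: sum_distrib_left of_real_sum)
    finally show ?thesis
      by (simp only: norm_mult cmod_add_character[OF \<psi>] norm_of_real mult_1)
  qed
  have "(L2_set ?M (carrier affine_group))\<^sup>2 = (\<Sum>k\<in>UNIV. \<Sum>l\<in>Fstar. (?M (k, l))\<^sup>2)"
    unfolding L2_set_def
    by (simp add: sum_nonneg affine_group_def sum.cartesian_product)
  also have "\<dots> = real CARD('a) * (\<Sum>l\<in>Fstar. (\<Sum>t\<in>T. x t * (\<phi> (l * t) * \<phi> (l * (t + s))))\<^sup>2)"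
    by (simp add: M)
  finally have L2: "(L2_set ?M (carrier affine_group))\<^sup>2 = \<dots>" .
  have At: "A t (t + s) \<noteq> 0" using t by (simp add: A_def)
  have pos: "0 < frob_norm A" by (rule frob_norm_pos[of t "t + s" A, OF t(1,2) At])
  have "1 \<le> L2_set ?M (carrier affine_group) / frob_norm A"
    using \<sigma> sigma_min_le[of t "t + s" A, OF t(1,2) At] by (rule order_trans)
  then have "frob_norm A \<le> L2_set ?M (carrier affine_group)"
    using pos by (simp add: le_divide_eq)
  then have "(frob_norm A)\<^sup>2 \<le> (L2_set ?M (carrier affine_group))\<^sup>2"
    using pos by (intro power_mono) simp_all
  then show ?thesis by (simp only: frob L2)
qed (simp add: sum_nonneg)

section \<open>Evaluation of a trace and of the character coefficients\<close>

text \<open>The pairs \<open>(m * t, m * (t + 1))\<close> run exactly once through all pairs of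
  distinct nonzero elements: the difference of the entries recovers \<open>m\<close>, and then
  \<open>t\<close>. With \<open>f\<close> the square of \<open>\<phi>\<close>, the left side is the
  trace of the Gram matrix of \<open>B_mat\<close>.\<close>

lemma sum_off_diagonal_products:
  fixes f :: "'a::{field,finite} \<Rightarrow> real"
  shows "(\<Sum>t\<in>UNIV - {0, - 1}. \<Sum>m\<in>Fstar. f (m * t) * f (m * (t + 1))) =
    (\<Sum>m\<in>Fstar. f m)\<^sup>2 - (\<Sum>m\<in>Fstar. (f m)\<^sup>2)"
proof -
  \<comment> \<open>Off the diagonal \<open>b - a\<close> is invertible; the excluded value
    \<open>t = - 1\<close> corresponds to a vanishing second entry.\<close>
  have shift: "(b - a) * (a / (b - a)) = a" and neg_one: "a / (b - a) = - 1 \<longleftrightarrow> b = 0"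
    if "(a, b) \<notin> (\<lambda>a. (a, a)) ` Fstar" "a \<noteq> 0" for a b :: 'a
    using that by (auto simp: divide_eq_eq)
  have mult_eq_neg: "b * a = - b \<longleftrightarrow> b = 0 \<or> a = - 1" for a b :: 'a
    using mult_cancel_left[of b a "- 1"] by simp
  have "(\<Sum>t\<in>UNIV - {0, - 1}. \<Sum>m\<in>Fstar. f (m * t) * f (m * (t + 1))) =
      (\<Sum>(t, m)\<in>(UNIV - {0, - 1}) \<times> Fstar. f (m * t) * f (m * (t + 1)))"
    by (simp add: sum.cartesian_product)
  also have "\<dots> = (\<Sum>(a, b)\<in>Fstar \<times> Fstar - (\<lambda>a. (a, a)) ` Fstar. f a * f b)"
    by (rule sum.reindex_bij_witness[of _ "\<lambda>(a, b). (a / (b - a), b - a)" "\<lambda>(t, m). (m * t, m * (t + 1))"])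
       (auto simp: shift neg_one mult_eq_neg add_eq_0_iff2 distrib_left)
  also have "\<dots> = (\<Sum>(a, b)\<in>Fstar \<times> Fstar. f a * f b) - (\<Sum>(a, b)\<in>(\<lambda>a. (a, a)) ` Fstar. f a * f b)"
    by (rule sum_diff) auto
  also have "(\<Sum>(a, b)\<in>(\<lambda>a. (a, a)) ` Fstar. f a * f b) = (\<Sum>a\<in>Fstar. (f a)\<^sup>2)"
    by (subst sum.reindex) (auto simp: inj_on_def power2_eq_square)
  also have "(\<Sum>(a, b)\<in>Fstar \<times> Fstar. f a * f b) = (\<Sum>m\<in>Fstar. f m)\<^sup>2"
    by (simp add: power2_eq_square sum_product sum.cartesian_product)
  finally show ?thesis .
qed

text \<open>The squared norm of the image of \<open>\<eta>\<close> under the matrix with entries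
  \<open>(\<phi> (l * m))\<^sup>2\<close> is computed twice: all entries of the image have the
  absolute value of \<open>c_coeff \<phi> \<eta>\<close>, while the Gram matrix acts on
  \<open>\<eta>\<close> as the scalar \<open>c\<close>.\<close>

lemma cmod_c_coeff_of_gram:
  fixes \<phi> :: "'a::{field,finite} \<Rightarrow> real" and \<eta> :: "'a \<Rightarrow> complex"
  assumes gram: "\<And>i j. i \<in> Fstar \<Longrightarrow> j \<in> Fstar \<Longrightarrow>
      (\<Sum>l\<in>Fstar. (\<phi> (l * i))\<^sup>2 * (\<phi> (l * j))\<^sup>2) = (if i = j then c else 0) + b"
    and \<eta>: "nontrivial_mult_character \<eta>"
  shows "(cmod (c_coeff \<phi> \<eta>))\<^sup>2 = c"
proof -
  have \<eta>': "mult_character \<eta>" using \<eta> by (simp add: nontrivial_mult_character_def)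
  have mult: "\<eta> (u * v) = \<eta> u * \<eta> v" if "u \<noteq> 0" "v \<noteq> 0" for u v
    using \<eta>' that by (simp add: mult_character_def)
  have unit: "\<eta> u * cnj (\<eta> u) = 1" if "u \<noteq> 0" for u
    by (simp add: complex_norm_square[symmetric] cmod_mult_character[OF \<eta>' that])
  let ?w = "\<lambda>l. \<Sum>m\<in>Fstar. of_real ((\<phi> (l * m))\<^sup>2) * \<eta> m"
  have w: "cmod (?w l) = cmod (c_coeff \<phi> \<eta>)" if l: "l \<in> Fstar" for l
  proof -
    \<comment> \<open>The substitution uses \<open>- l\<close> because \<open>c_coeff\<close>
      evaluates \<phi> at \<open>- m\<close>.\<close>
    have "c_coeff \<phi> \<eta> = (\<Sum>m\<in>Fstar. of_real ((\<phi> (- (- l * m)))\<^sup>2) * \<eta> (- l * m))"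
      using sum_Fstar_mult[of "- l" "\<lambda>m. of_real ((\<phi> (- m))\<^sup>2) * \<eta> m"] l
      by (simp add: c_coeff_def)
    also have "\<dots> = \<eta> (- l) * ?w l"
      using l mult[of "- l"] by (simp add: sum_distrib_left mult_ac)
    finally show ?thesis using cmod_mult_character[OF \<eta>', of "- l"] l by (simp add: norm_mult)
  qed
  have "complex_of_real (\<Sum>l\<in>Fstar. (cmod (?w l))\<^sup>2) = (\<Sum>l\<in>Fstar. ?w l * cnj (?w l))"
    by (simp only: of_real_sum complex_norm_square)
  also have "\<dots> = (\<Sum>l\<in>Fstar. \<Sum>i\<in>Fstar. \<Sum>j\<in>Fstar.
      \<eta> i * cnj (\<eta> j) * of_real ((\<phi> (l * i))\<^sup>2 * (\<phi> (l * j))\<^sup>2))"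
    by (simp add: sum_product mult_ac)
  also have "\<dots> = (\<Sum>i\<in>Fstar. \<Sum>j\<in>Fstar. \<Sum>l\<in>Fstar.
      \<eta> i * cnj (\<eta> j) * of_real ((\<phi> (l * i))\<^sup>2 * (\<phi> (l * j))\<^sup>2))"
    by (subst sum.swap) (intro sum.cong refl sum.swap)
  also have "\<dots> = (\<Sum>i\<in>Fstar. \<Sum>j\<in>Fstar. \<eta> i * cnj (\<eta> j) *
      of_real (\<Sum>l\<in>Fstar. (\<phi> (l * i))\<^sup>2 * (\<phi> (l * j))\<^sup>2))"
    by (simp only: of_real_sum sum_distrib_left)
  \<comment> \<open>The constant part \<open>b\<close> leaves a product of two character sums, which
    vanish for nontrivial \<open>\<eta>\<close>.\<close>
  also have "\<dots> = (\<Sum>i\<in>Fstar. \<Sum>j\<in>Fstar. (if i = j then of_real c else 0) + \<eta> i * cnj (\<eta> j) * of_real b)"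
    by (intro sum.cong refl) (auto simp: gram distrib_left unit)
  also have "\<dots> = of_real c * of_nat (card (Fstar :: 'a set)) +
      (\<Sum>i\<in>Fstar. \<eta> i) * cnj (\<Sum>j\<in>Fstar. \<eta> j) * of_real b"
    by (simp add: sum.distrib sum_product flip: sum_distrib_right)
  also have "\<dots> = of_real (c * real (card (Fstar :: 'a set)))"
    by (simp add: sum_nontrivial_mult_character[OF \<eta>])
  finally have "(\<Sum>l\<in>Fstar. (cmod (?w l))\<^sup>2) = c * real (card (Fstar :: 'a set))"
    by (simp only: of_real_eq_iff)
  moreover have "(\<Sum>l\<in>Fstar. (cmod (?w l))\<^sup>2) = (cmod (c_coeff \<phi> \<eta>))\<^sup>2 * real (card (Fstar :: 'a set))"
    by (subst sum.cong[OF refl, where h = "\<lambda>_. (cmod (c_coeff \<phi> \<eta>))\<^sup>2"])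
       (simp_all only: w, simp)
  moreover have "real (card (Fstar :: 'a set)) \<noteq> 0"
    using card_Fstar[where 'a='a] card_two_le[where 'a='a] by linarith
  ultimately show ?thesis by (metis mult_right_cancel)
qed

section \<open>Comparison of the two traces and the equality case\<close>

theorem proposition6p23:
  fixes \<psi> :: "'a::{field,finite} \<Rightarrow> complex" and \<phi> :: "'a \<Rightarrow> real"
  assumes "odd CARD('a)"
    and "nontrivial_add_character \<psi>"
    and "L2_set \<phi> Fstar = 1"
    and "sigma_min \<psi> (\<lambda>m. complex_of_real (\<phi> m)) = 1"
  shows "(\<Sum>m\<in>Fstar. \<bar>\<phi> m\<bar> ^ 4) = 2 / real CARD('a)
    \<and> (\<forall>\<eta> :: 'a \<Rightarrow> complex. nontrivial_mult_character \<eta> \<longrightarrow>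
          cmod (c_coeff \<phi> \<eta>) = 1 / sqrt (real CARD('a)))
    \<and> (\<forall>t\<in>UNIV - {0, - 1}. \<forall>t'\<in>UNIV - {0, - 1}.
          (\<Sum>m\<in>Fstar. B_mat \<phi> m t * B_mat \<phi> m t')
            = (if t = t' then 1 / real CARD('a) else 0))"
proof -
  define q where "q = real CARD('a)"
  define d where "d = real (card (Fstar :: 'a set))"
  define S where "S = (\<Sum>m\<in>Fstar. \<bar>\<phi> m\<bar> ^ 4)"
  define T where "T = UNIV - {0, - 1 :: 'a}"
  \<comment> \<open>\<open>P\<close> and \<open>Q\<close> are the deficits in the two matrix
    inequalities. Their traces come out as \<open>2 / q - S\<close> and
    \<open>d * (S - 2 / q)\<close>, of opposite sign, so positivity of both forces both to
    vanish.\<close>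
  define P where "P i j = (\<Sum>l\<in>Fstar. B_mat \<phi> l i * B_mat \<phi> l j) - (if i = j then 1 / q else 0)"
    for i j
  define C where "C l m = (\<phi> (l * m))\<^sup>2" for l m
  define Q where "Q i j = (\<Sum>l\<in>Fstar. C l i * C l j) - (if i = j then 1 / q else 0) - 1 / q" for i j
  have q: "2 \<le> q" using card_two_le[where 'a='a] by (simp add: q_def)
  have d: "d = q - 1" "0 < d" using card_Fstar[where 'a='a] q by (simp_all add: d_def q_def)
  have \<psi>: "add_character \<psi>" using assms(2) by (simp add: nontrivial_add_character_def)
  note bound = shifted_diagonal_bound[OF \<psi>, of \<phi>, unfolded assms(4), OF order_refl, folded q_def]
  have unit: "(\<Sum>m\<in>Fstar. (\<phi> m)\<^sup>2) = 1"
    using assms(3) by (simp add: L2_set_def)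
  have S: "S = (\<Sum>m\<in>Fstar. ((\<phi> m)\<^sup>2)\<^sup>2)"
    by (simp add: S_def power_even_abs flip: power_mult)

  have P_psd: "0 \<le> (\<Sum>i\<in>T. \<Sum>j\<in>T. x i * x j * P i j)" for x
  proof -
    have T: "{t :: 'a. t \<noteq> 0 \<and> t + 1 \<noteq> 0} = T" by (auto simp: T_def add_eq_0_iff2)
    have "(\<Sum>i\<in>T. (x i)\<^sup>2) \<le> q * (\<Sum>l\<in>Fstar. (\<Sum>i\<in>T. x i * B_mat \<phi> l i)\<^sup>2)"
      using bound[where s = 1 and x = x] by (simp only: T B_mat_def)
    then have "(1 / q) * (\<Sum>i\<in>T. (x i)\<^sup>2) \<le> (\<Sum>l\<in>Fstar. (\<Sum>i\<in>T. x i * B_mat \<phi> l i)\<^sup>2)"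
      using q by (simp add: field_simps)
    moreover have "(\<Sum>i\<in>T. \<Sum>j\<in>T. x i * x j * P i j) =
        (\<Sum>l\<in>Fstar. (\<Sum>i\<in>T. x i * B_mat \<phi> l i)\<^sup>2) - (1 / q) * (\<Sum>i\<in>T. (x i)\<^sup>2)"
      by (simp only: P_def right_diff_distrib sum_subtractf sum_square_gram sum_square_diag finite)
    ultimately show ?thesis by linarith
  qed
  \<comment> \<open>The Gram trace is \<open>1 - S\<close>, and \<open>T\<close> has
    \<open>q - 2\<close> elements, so \<open>(q - 2) / q\<close> is subtracted.\<close>
  have P_trace: "(\<Sum>i\<in>T. P i i) = 2 / q - S"
  proof -
    have "(\<Sum>i\<in>T. \<Sum>l\<in>Fstar. B_mat \<phi> l i * B_mat \<phi> l i) = 1 - S"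
      using sum_off_diagonal_products[of "\<lambda>m. (\<phi> m)\<^sup>2"]
      unfolding unit by (simp add: T_def B_mat_def S power2_eq_square mult_ac)
    then show ?thesis
      using card_no_zero_neg_one[where 'a='a] q
      by (simp add: P_def sum_subtractf flip: T_def q_def) (simp add: field_simps)
  qed

  \<comment> \<open>\<open>C\<close> is doubly stochastic because \<phi> is a unit vector.\<close>
  have C_col: "(\<Sum>l\<in>Fstar. C l m) = 1" if "m \<in> Fstar" for m
    using sum_Fstar_mult[of m "\<lambda>l. (\<phi> l)\<^sup>2"] that by (simp add: C_def unit mult.commute)
  have C_row: "(\<Sum>m\<in>Fstar. C l m) = 1" if "l \<in> Fstar" for l
    using sum_Fstar_mult[of l "\<lambda>l. (\<phi> l)\<^sup>2"] that by (simp add: C_def unit)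
  \<comment> \<open>The bound is applied to the centred vector \<open>?y\<close>. Since
    \<open>C\<close> preserves both constants and sums, centring lowers the squared norms of
    \<open>x\<close> and of its image \<open>z\<close> by the same \<open>s\<^sup>2 / d\<close>. The
    factor \<open>q = d + 1\<close> on one side leaves an extra \<open>s\<^sup>2\<close>, the
    quadratic form of the all-ones matrix.\<close>
  have Q_psd: "0 \<le> (\<Sum>i\<in>Fstar. \<Sum>j\<in>Fstar. x i * x j * Q i j)" for x
  proof -
    define s where "s = (\<Sum>i\<in>Fstar. x i)"
    define z where "z l = (\<Sum>i\<in>Fstar. x i * C l i)" for l
    let ?y = "\<lambda>i. x i - s / d"
    have mean_sq: "(\<Sum>i\<in>Fstar. (f i - s / d)\<^sup>2) = (\<Sum>i\<in>Fstar. (f i)\<^sup>2) - s\<^sup>2 / d"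
      if "(\<Sum>i\<in>Fstar. f i) = s" for f :: "'a \<Rightarrow> real"
    proof -
      have "(\<Sum>i\<in>Fstar. (f i - s / d)\<^sup>2) =
          (\<Sum>i\<in>Fstar. (f i)\<^sup>2) + d * (s / d)\<^sup>2 - 2 * (\<Sum>i\<in>Fstar. f i) * (s / d)"
        by (simp add: power2_diff sum_subtractf sum.distrib sum_distrib_left sum_distrib_right
            sum_divide_distrib d_def)
      moreover have "d * (s / d)\<^sup>2 - 2 * s * (s / d) = - (s\<^sup>2 / d)"
        using d(2) by (simp add: field_simps power2_eq_square)
      ultimately show ?thesis unfolding that by linarith
    qed
    have z_sum: "(\<Sum>l\<in>Fstar. z l) = s"
      unfolding z_def s_def by (subst sum.swap) (simp add: C_col flip: sum_distrib_left)
    have z_y: "(\<Sum>i\<in>Fstar. ?y i * C l i) = z l - s / d" if "l \<in> Fstar" for l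
      by (simp add: z_def left_diff_distrib sum_subtractf C_row[OF that]
          flip: sum_distrib_left sum_divide_distrib)
    have "(\<Sum>i\<in>Fstar. (?y i)\<^sup>2) \<le> q * (\<Sum>l\<in>Fstar. (\<Sum>i\<in>Fstar. ?y i * C l i)\<^sup>2)"
      using bound[where s = 0 and x = ?y] by (simp add: C_def power2_eq_square)
    also have "(\<Sum>l\<in>Fstar. (\<Sum>i\<in>Fstar. ?y i * C l i)\<^sup>2) = (\<Sum>l\<in>Fstar. (z l - s / d)\<^sup>2)"
      by (simp add: z_y)
    finally have "(\<Sum>i\<in>Fstar. (x i)\<^sup>2) - s\<^sup>2 / d \<le> q * ((\<Sum>l\<in>Fstar. (z l)\<^sup>2) - s\<^sup>2 / d)"
      by (simp add: mean_sq z_sum s_def[symmetric])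
    moreover have "q * (s\<^sup>2 / d) - s\<^sup>2 / d = s\<^sup>2"
    proof -
      have "q * (s\<^sup>2 / d) - s\<^sup>2 / d = d * (s\<^sup>2 / d)"
        by (simp only: d(1) left_diff_distrib mult_1)
      then show ?thesis using d(2) by simp
    qed
    ultimately have "(\<Sum>i\<in>Fstar. (x i)\<^sup>2) + s\<^sup>2 \<le> q * (\<Sum>l\<in>Fstar. (z l)\<^sup>2)"
      by (simp add: right_diff_distrib)
    then have "(1 / q) * (\<Sum>i\<in>Fstar. (x i)\<^sup>2) + s\<^sup>2 / q \<le> (\<Sum>l\<in>Fstar. (z l)\<^sup>2)"
      using q by (simp add: field_simps)
    moreover have "(\<Sum>i\<in>Fstar. \<Sum>j\<in>Fstar. x i * x j * (1 / q)) = s\<^sup>2 / q"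
      by (simp add: s_def power2_eq_square sum_product sum_divide_distrib)
    then have "(\<Sum>i\<in>Fstar. \<Sum>j\<in>Fstar. x i * x j * Q i j) =
        (\<Sum>l\<in>Fstar. (z l)\<^sup>2) - (1 / q) * (\<Sum>i\<in>Fstar. (x i)\<^sup>2) - s\<^sup>2 / q"
      by (simp only: Q_def z_def right_diff_distrib sum_subtractf sum_square_gram sum_square_diag finite)
    ultimately show ?thesis by linarith
  qed
  have Q_trace: "(\<Sum>i\<in>Fstar. Q i i) = d * (S - 2 / q)"
  proof -
    have "(\<Sum>l\<in>Fstar. C l i * C l i) = S" if "i \<in> Fstar" for i
      using sum_Fstar_mult[of i "\<lambda>l. ((\<phi> l)\<^sup>2)\<^sup>2"] that
      by (simp add: C_def S mult.commute flip: power2_eq_square)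
    then have "Q i i = S - 2 / q" if "i \<in> Fstar" for i using that by (simp add: Q_def)
    then show ?thesis by (simp add: d_def)
  qed

  \<comment> \<open>Each nonnegative trace bounds \<open>S\<close> from one side.\<close>
  have "S \<le> 2 / q" using psd_trace_nonneg[OF _ P_psd] by (simp add: P_trace)
  moreover have "2 / q \<le> S"
    using psd_trace_nonneg[OF _ Q_psd] d(2) by (simp add: Q_trace zero_le_mult_iff)
  ultimately have S_eq: "S = 2 / q" by simp
  have P0: "P i j = 0" if "i \<in> T" "j \<in> T" for i j
    by (rule psd_zero_of_trace_le_zero[of T P, OF _ _ P_psd _ that])
       (simp_all add: P_trace S_eq, simp add: P_def mult.commute)
  have Q0: "Q i j = 0" if "i \<in> Fstar" "j \<in> Fstar" for i j
    by (rule psd_zero_of_trace_le_zero[of Fstar Q, OF _ _ Q_psd _ that])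
       (simp_all add: Q_trace S_eq, simp add: Q_def mult.commute)
  have "cmod (c_coeff \<phi> \<eta>) = 1 / sqrt q" if "nontrivial_mult_character \<eta>" for \<eta>
  proof -
    have "(cmod (c_coeff \<phi> \<eta>))\<^sup>2 = 1 / q"
      by (rule cmod_c_coeff_of_gram[where b = "1 / q", OF _ that])
         (use Q0 in \<open>simp add: Q_def C_def algebra_simps\<close>)
    then have "cmod (c_coeff \<phi> \<eta>) = sqrt (1 / q)" by (metis norm_ge_zero real_sqrt_unique)
    then show ?thesis by (simp add: real_sqrt_divide)
  qed
  moreover have "(\<Sum>m\<in>Fstar. B_mat \<phi> m t * B_mat \<phi> m t') = (if t = t' then 1 / q else 0)"
    if "t \<in> T" "t' \<in> T" for t t'
    using P0[OF that] by (simp add: P_def)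
  ultimately show ?thesis
    using S_eq unfolding S_def T_def q_def by blast
qed

end
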